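(* Let $R=K[x_1,\dots,x_n]$ be a polynomial ring over a field $K$, and let $I=\mathrm{Sss}(\{\lambda\})\subset R$ be a principal Borel symmetric strongly shifted ideal, $\lambda\in P_n$. Then $I$ satisfies the strong exchange property if and only if $\lambda$ is of one of the following types: (1) $\lambda=(a,\dots,a)$ for some $0\ne a\in\mathbb N$; (2) $\lambda=(a^s,b^{n-s})$ for some $a<b$ in $\mathbb N$ and $s>0$; (3) $\lambda=(a^s,b,c^{n-s-1})$ for some $a<b<c$ in $\mathbb N$ and $s>0$.
   Context: $\mathfrak S_n$ acts on $R$ by permuting variables. $P_n=\{\lambda\in\mathbb Z^n: 0\le\lambda_1\le\cdots\le\lambda_n\}$, $x^\lambda=x_1^{\lambda_1}\cdots x_n^{\lambda_n}$; $\mathbb N$ includes $0$; exponents in $(a^s,b^{n-s})$ denote multiplicities of parts. For an $\mathfrak S_n$-fixed monomial ideal $I$ put $P(I)=\{\lambda\in P_n: x^\lambda\in I\}$. An $\mathfrak S_n$-fixed monomial ideal $I$ is symmetric strongly shifted if for every $\lambda\in P(I)$ and $1\le i<j\le n$ with $\lambda_i<\lambda_j$ one has $x^\lambda x_i/x_j\in I$. $\mathrm{Sss}(\{\lambda\})$ is the smallest symmetric strongly shifted ideal containing $x^\lambda$. All ideals considered are proper (so $\lambda\neq0$). Such an $I$ (generated in a single degree, and polymatroidal) satisfies the strong exchange property if for any two distinct minimal monomial generators $x^u,x^v$ of $I$ and all indices $i,j$ with $u_i>v_i$ and $u_j<v_j$, one has $x^ux_j/x_i\in I$. *)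

theory Defs
  imports "HOL-Library.Poly_Mapping" "HOL-Combinatorics.Permutations" "HOL-Algebra.Ideal"
begin

text \<open>
  An exponent vector is a finitely supported map on the naturals; those of
  \<open>n\<close> variables are supported on \<open>{1..n}\<close>. Accordingly \<open>K[x\<^sub>1,\<dots>,x\<^sub>n]\<close> is the subring, of the
  monoid algebra of all exponent vectors, formed by the elements supported on such vectors.
\<close>

type_synonym expo = "nat \<Rightarrow>\<^sub>0 nat"
type_synonym 'k mpol = "expo \<Rightarrow>\<^sub>0 'k"

abbreviation keys :: "('a \<Rightarrow>\<^sub>0 'b::zero) \<Rightarrow> 'a set" where
  "keys \<equiv> Poly_Mapping.keys"

abbreviation lookup :: "('a \<Rightarrow>\<^sub>0 'b::zero) \<Rightarrow> 'a \<Rightarrow> 'b" where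
  "lookup \<equiv> Poly_Mapping.lookup"

definition expos :: "nat \<Rightarrow> expo set" where
  "expos n = {m. keys m \<subseteq> {1..n}}"

definition poly_ring :: "nat \<Rightarrow> ('k::field) mpol ring" where
  "poly_ring n = \<lparr>carrier = {p. keys p \<subseteq> expos n}, monoid.mult = (*), one = 1,
                  zero = 0, add = (+)\<rparr>"

definition xmon :: "expo \<Rightarrow> ('k::field) mpol" where
  "xmon m = Poly_Mapping.single m 1"

abbreviation evar :: "nat \<Rightarrow> expo" where
  "evar i \<equiv> Poly_Mapping.single i 1"

definition Pn :: "nat \<Rightarrow> expo set" where
  "Pn n = {l \<in> expos n. \<forall>i\<in>{1..n}. \<forall>j\<in>{1..n}. i \<le> j \<longrightarrow> lookup l i \<le> lookup l j}"

text \<open>The action of a permutation \<open>s\<close> is the one sending \<open>x\<^sub>i\<close> to \<open>x\<^sub>j\<close> with \<open>j = s i\<close>.\<close>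

definition perm_expo :: "(nat \<Rightarrow> nat) \<Rightarrow> expo \<Rightarrow> expo" where
  "perm_expo s m = Poly_Mapping.map_key (inv_into UNIV s) m"

definition perm_poly :: "(nat \<Rightarrow> nat) \<Rightarrow> ('k::field) mpol \<Rightarrow> 'k mpol" where
  "perm_poly s p = (\<Sum>m\<in>keys p. Poly_Mapping.single (perm_expo s m) (lookup p m))"

definition monomial_ideal :: "nat \<Rightarrow> ('k::field) mpol set \<Rightarrow> bool" where
  "monomial_ideal n I \<longleftrightarrow> (\<exists>M \<subseteq> expos n. I = Idl\<^bsub>poly_ring n\<^esub> (xmon ` M))"

definition sym_fixed :: "nat \<Rightarrow> ('k::field) mpol set \<Rightarrow> bool" where
  "sym_fixed n I \<longleftrightarrow> (\<forall>s. s permutes {1..n} \<longrightarrow> perm_poly s ` I = I)"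

definition P_of :: "nat \<Rightarrow> ('k::field) mpol set \<Rightarrow> expo set" where
  "P_of n I = {l \<in> Pn n. xmon l \<in> I}"

text \<open>
  Subtraction of exponent vectors is truncated; wherever \<open>evar\<close> is subtracted below,
  the corresponding exponent is positive.
\<close>

definition sym_strongly_shifted :: "nat \<Rightarrow> ('k::field) mpol set \<Rightarrow> bool" where
  "sym_strongly_shifted n I \<longleftrightarrow> monomial_ideal n I \<and> sym_fixed n I \<and>
     (\<forall>l \<in> P_of n I. \<forall>i\<in>{1..n}. \<forall>j\<in>{1..n}. i < j \<longrightarrow> lookup l i < lookup l j \<longrightarrow>
        xmon (l + evar i - evar j) \<in> I)"

definition Sss :: "nat \<Rightarrow> expo set \<Rightarrow> ('k::field) mpol set" where
  "Sss n B = \<Inter>{I. sym_strongly_shifted n I \<and> xmon ` B \<subseteq> I}"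

text \<open>Exponent vectors of the minimal monomial generators.\<close>

definition min_gens :: "nat \<Rightarrow> ('k::field) mpol set \<Rightarrow> expo set" where
  "min_gens n I = {u \<in> expos n. xmon u \<in> I \<and>
     (\<forall>v \<in> expos n. xmon v \<in> I \<and> (\<forall>i. lookup v i \<le> lookup u i) \<longrightarrow> v = u)}"

definition strong_exchange :: "nat \<Rightarrow> ('k::field) mpol set \<Rightarrow> bool" where
  "strong_exchange n I \<longleftrightarrow>
     (\<forall>u \<in> min_gens n I. \<forall>v \<in> min_gens n I. u \<noteq> v \<longrightarrow>
        (\<forall>i\<in>{1..n}. \<forall>j\<in>{1..n}. lookup u i > lookup v i \<and> lookup u j < lookup v j \<longrightarrow>
           xmon (u + evar j - evar i) \<in> I))"

lemma poly_mapping_sum_monomials: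
  "(\<Sum>m\<in>keys p. Poly_Mapping.single m (lookup p m)) = p"
  by (rule poly_mapping_eqI)
    (simp add: lookup_sum lookup_single when_def sum.delta' in_keys_iff)

lemma expos_add: "a \<in> expos n \<Longrightarrow> b \<in> expos n \<Longrightarrow> a + b \<in> expos n"
  using keys_add[of a b] by (auto simp: expos_def)

lemma expos_zero: "0 \<in> expos n"
  by (simp add: expos_def)

lemma carrier_mult:
  fixes p q :: "('k::field) mpol"
  assumes "keys p \<subseteq> expos n" "keys q \<subseteq> expos n"
  shows "keys (p * q) \<subseteq> expos n"
  using keys_mult[of p q] assms expos_add by blast

lemma cring_poly_ring: "cring (poly_ring n :: ('k::field) mpol ring)"
proof (rule cringI)
  show "abelian_group (poly_ring n :: 'k mpol ring)"
  proof (rule abelian_groupI)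
    fix x y :: "'k mpol"
    assume "x \<in> carrier (poly_ring n)" "y \<in> carrier (poly_ring n)"
    then show "x \<oplus>\<^bsub>poly_ring n\<^esub> y \<in> carrier (poly_ring n)"
      using keys_add[of x y] by (auto simp: poly_ring_def)
  next
    fix x :: "'k mpol"
    assume "x \<in> carrier (poly_ring n)"
    then show "\<exists>y\<in>carrier (poly_ring n). y \<oplus>\<^bsub>poly_ring n\<^esub> x = \<zero>\<^bsub>poly_ring n\<^esub>"
      by (intro bexI[of _ "- x"]) (auto simp: poly_ring_def in_keys_iff)
  qed (auto simp: poly_ring_def algebra_simps)
  show "comm_monoid (poly_ring n :: 'k mpol ring)"
    by (rule comm_monoidI) (simp_all add: poly_ring_def carrier_mult expos_zero algebra_simps)
qed (auto simp: poly_ring_def algebra_simps)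

lemma ring_poly_ring: "ring (poly_ring n :: ('k::field) mpol ring)"
  using cring_poly_ring cring.axioms(1) by blast

lemma xmon_mult: "xmon (a + b) = xmon a * xmon b"
  by (simp add: xmon_def mult_single)

lemma xmon_carrier: "m \<in> expos n \<Longrightarrow> xmon m \<in> carrier (poly_ring n)"
  by (simp add: poly_ring_def xmon_def)

lemma ideal_poly_ring_iff:
  fixes I :: "('k::field) mpol set"
  shows "ideal I (poly_ring n) \<longleftrightarrow> I \<subseteq> carrier (poly_ring n) \<and> 0 \<in> I \<and>
    (\<forall>p\<in>I. \<forall>q\<in>I. p + q \<in> I) \<and> (\<forall>r\<in>carrier (poly_ring n). \<forall>p\<in>I. r * p \<in> I)"
    (is "?l \<longleftrightarrow> ?r")
proof
  assume l: ?l
  interpret ideal I "poly_ring n" by (rule l)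
  have "0 \<in> I" using additive_subgroup.zero_closed[OF is_additive_subgroup]
    by (simp add: poly_ring_def)
  moreover have "p + q \<in> I" if "p \<in> I" "q \<in> I" for p q
    using additive_subgroup.a_closed[OF is_additive_subgroup that] by (simp add: poly_ring_def)
  moreover have "r * p \<in> I" if "r \<in> carrier (poly_ring n)" "p \<in> I" for r p
    using I_l_closed[OF that(2,1)] by (simp add: poly_ring_def)
  ultimately show ?r using a_subset by blast
next
  assume r: ?r
  have neg: "- p \<in> I" if "p \<in> I" for p
  proof -
    have "keys (- 1 :: 'k mpol) \<subseteq> expos n" using expos_zero by simp
    then have "- 1 \<in> carrier (poly_ring n :: 'k mpol ring)" by (simp add: poly_ring_def)
    then have "(- 1) * p \<in> I" using r that by blast
    then show ?thesis by simp
  qed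
  interpret R: ring "poly_ring n :: 'k mpol ring" by (rule ring_poly_ring)
  have inv: "inv\<^bsub>add_monoid (poly_ring n)\<^esub> p = - p" if "p \<in> I" for p
  proof -
    have "p \<in> carrier (poly_ring n)" "- p \<in> carrier (poly_ring n)" using that neg r by auto
    then have "\<ominus>\<^bsub>poly_ring n\<^esub> p = - p"
      by (intro R.minus_equality) (auto simp: poly_ring_def)
    then show ?thesis by (simp add: a_inv_def)
  qed
  show ?l
  proof (rule idealI[OF ring_poly_ring])
    show "subgroup I (add_monoid (poly_ring n))"
      using r neg inv by (intro group.subgroupI R.add.is_group) (auto simp: poly_ring_def)
  next
    fix a x :: "'k mpol" assume a: "a \<in> I" and x: "x \<in> carrier (poly_ring n)"
    have "x * a \<in> I" using r a x by blast
    then show "x \<otimes>\<^bsub>poly_ring n\<^esub> a \<in> I" "a \<otimes>\<^bsub>poly_ring n\<^esub> x \<in> I"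
      by (simp_all add: poly_ring_def mult.commute)
  qed
qed

lemma genideal_ideal:
  assumes "M \<subseteq> expos n"
  shows "ideal (Idl\<^bsub>poly_ring n\<^esub> (xmon ` M :: ('k::field) mpol set)) (poly_ring n)"
  using ring.genideal_ideal[OF ring_poly_ring] assms xmon_carrier by blast

text \<open>An ideal is monomial iff it contains the monomials of each of its elements.\<close>

lemma monomial_ideal_iff:
  fixes I :: "('k::field) mpol set"
  shows "monomial_ideal n I \<longleftrightarrow> ideal I (poly_ring n) \<and> (\<forall>p\<in>I. \<forall>m\<in>keys p. xmon m \<in> I)"
proof (intro iffI conjI)
  assume "monomial_ideal n I"
  then obtain M where M: "M \<subseteq> expos n" and I: "I = Idl\<^bsub>poly_ring n\<^esub> (xmon ` M)"
    unfolding monomial_ideal_def by auto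
  show id: "ideal I (poly_ring n)" unfolding I by (rule genideal_ideal[OF M])
  note idD = id[unfolded ideal_poly_ring_iff]
  define J where "J = {p \<in> carrier (poly_ring n :: 'k mpol ring). \<forall>m\<in>keys p. (xmon m :: 'k mpol) \<in> I}"
  have "ideal J (poly_ring n)"
    unfolding ideal_poly_ring_iff
  proof (intro conjI ballI)
    show "J \<subseteq> carrier (poly_ring n)" "0 \<in> J" by (auto simp: J_def poly_ring_def)
  next
    fix p q assume "p \<in> J" "q \<in> J"
    then show "p + q \<in> J"
      using keys_add[of p q] by (fastforce simp: J_def poly_ring_def)
  next
    fix r p :: "'k mpol" assume r: "r \<in> carrier (poly_ring n)" and p: "p \<in> J"
    have "xmon m \<in> I" if "m \<in> keys (r * p)" for m
    proof -
      obtain a b where ab: "m = a + b" "a \<in> keys r" "b \<in> keys p"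
        using \<open>m \<in> keys (r * p)\<close> keys_mult[of r p] by auto
      then have "a \<in> expos n" using r by (auto simp: poly_ring_def)
      then have "xmon a \<in> carrier (poly_ring n :: 'k mpol ring)" by (rule xmon_carrier)
      then have "xmon a * xmon b \<in> I" using idD ab p by (auto simp: J_def)
      then show ?thesis using ab xmon_mult by metis
    qed
    then show "r * p \<in> J"
      using r p carrier_mult[of r n p] by (auto simp: J_def poly_ring_def)
  qed
  moreover have "xmon ` M \<subseteq> I" unfolding I genideal_def by auto
  then have "xmon ` M \<subseteq> J"
    using M xmon_carrier by (auto simp: J_def xmon_def)
  ultimately have "I \<subseteq> J" unfolding I genideal_def by blast
  then show "\<forall>p\<in>I. \<forall>m\<in>keys p. xmon m \<in> I" by (auto simp: J_def)
next
  assume *: "ideal I (poly_ring n) \<and> (\<forall>p\<in>I. \<forall>m\<in>keys p. xmon m \<in> I)"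
  define M where "M = {m \<in> expos n. (xmon m :: 'k mpol) \<in> I}"
  have sub: "I \<subseteq> J" if J: "ideal J (poly_ring n)" and MJ: "xmon ` M \<subseteq> J" for J :: "'k mpol set"
  proof
    fix p assume p: "p \<in> I"
    note JD = J[unfolded ideal_poly_ring_iff]
    have fin: "(\<Sum>m\<in>A. Poly_Mapping.single m (lookup p m)) \<in> J"
      if "finite A" "A \<subseteq> keys p" for A
      using that
    proof (induction A rule: finite_induct)
      case empty then show ?case using JD by auto
    next
      case (insert m A)
      have "p \<in> carrier (poly_ring n)" using p * unfolding ideal_poly_ring_iff by blast
      then have "m \<in> M" using insert.prems p * by (auto simp: M_def poly_ring_def)
      then have "xmon m \<in> J" using MJ by auto
      moreover have "Poly_Mapping.single 0 (lookup p m) \<in> carrier (poly_ring n)"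
        using expos_zero by (auto simp: poly_ring_def)
      ultimately have "Poly_Mapping.single 0 (lookup p m) * xmon m \<in> J" using JD by blast
      then have "Poly_Mapping.single m (lookup p m) \<in> J" by (simp add: xmon_def mult_single)
      then show ?case using insert JD by simp
    qed
    have "p = (\<Sum>m\<in>keys p. Poly_Mapping.single m (lookup p m))"
      by (simp add: poly_mapping_sum_monomials)
    then show "p \<in> J" using fin[of "keys p"] by simp
  qed
  have "I = Idl\<^bsub>poly_ring n\<^esub> (xmon ` M)"
  proof
    show "I \<subseteq> Idl\<^bsub>poly_ring n\<^esub> (xmon ` M)" unfolding genideal_def using sub by blast
    have "xmon ` M \<subseteq> I" by (auto simp: M_def)
    then show "Idl\<^bsub>poly_ring n\<^esub> (xmon ` M) \<subseteq> I" unfolding genideal_def using * by blast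
  qed
  moreover have "M \<subseteq> expos n" by (auto simp: M_def)
  ultimately show "monomial_ideal n I" unfolding monomial_ideal_def by blast
qed

lemma lookup_perm_expo:
  assumes "s permutes A" shows "lookup (perm_expo s m) i = lookup m (inv_into UNIV s i)"
  using permutes_inj[OF permutes_inv[OF assms]] by (simp add: perm_expo_def map_key.rep_eq)

lemma perm_expo_inv:
  assumes "s permutes A"
  shows "perm_expo (inv_into UNIV s) (perm_expo s m) = m" "perm_expo s (perm_expo (inv_into UNIV s) m) = m"
  using assms permutes_inv[OF assms] 
  by (auto intro!: poly_mapping_eqI simp: lookup_perm_expo permutes_inv_inv permutes_inverses)

lemma lookup_perm_poly:
  assumes "s permutes A"
  shows "lookup (perm_poly s p) m = lookup p (perm_expo (inv_into UNIV s) m)"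
proof -
  have "lookup (perm_poly s p) m =
      (\<Sum>k\<in>keys p. if k = perm_expo (inv_into UNIV s) m then lookup p k else 0)"
    unfolding perm_poly_def lookup_sum
    by (intro sum.cong) (auto simp: lookup_single when_def perm_expo_inv[OF assms])
  then show ?thesis by (simp add: in_keys_iff)
qed

lemma perm_poly_inv:
  assumes "s permutes A" shows "perm_poly s (perm_poly (inv_into UNIV s) p) = p"
  using assms permutes_inv[OF assms]
  by (intro poly_mapping_eqI)
    (simp add: lookup_perm_poly[of s A] lookup_perm_poly[of "inv_into UNIV s" A] permutes_inv_inv perm_expo_inv)

text \<open>\<open>Sss n B\<close> is indeed the smallest symmetric strongly shifted ideal containing \<open>B\<close>.\<close>

lemma sym_strongly_shifted_carrier:
  "sym_strongly_shifted n (carrier (poly_ring n :: ('k::field) mpol ring))"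
proof -
  let ?R = "poly_ring n :: 'k mpol ring"
  have "monomial_ideal n (carrier ?R)"
    unfolding monomial_ideal_iff
    using ring.oneideal[OF ring_poly_ring] xmon_carrier by (auto simp: poly_ring_def xmon_def)
  moreover have pe: "perm_expo s m \<in> expos n" if s: "s permutes {1..n}" and "m \<in> expos n" for s m
  proof -
    have "i \<in> {1..n}" if "lookup m (inv_into UNIV s i) \<noteq> 0" for i
      using that \<open>m \<in> expos n\<close> permutes_in_image[OF permutes_inv[OF s], of i]
      unfolding expos_def by (metis (no_types, lifting) in_keys_iff mem_Collect_eq subsetD)
    then show ?thesis by (auto simp: expos_def in_keys_iff lookup_perm_expo[OF s])
  qed
  have c: "perm_poly s p \<in> carrier ?R" if s: "s permutes {1..n}" and p: "p \<in> carrier ?R" for s p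
  proof -
    have "m \<in> expos n" if "m \<in> keys (perm_poly s p)" for m
    proof -
      have "perm_expo (inv_into UNIV s) m \<in> expos n"
        using that p by (auto simp: in_keys_iff lookup_perm_poly[OF s] poly_ring_def)
      then show ?thesis using pe[OF s] perm_expo_inv(2)[OF s] by metis
    qed
    then show ?thesis by (auto simp: poly_ring_def)
  qed
  have "sym_fixed n (carrier ?R)"
    unfolding sym_fixed_def
  proof (intro allI impI equalityI subsetI)
    fix s p assume s: "s permutes {1..n}" and p: "p \<in> carrier ?R"
    show "p \<in> perm_poly s ` carrier ?R"
      using c[OF permutes_inv[OF s] p] perm_poly_inv[OF s, of p] by (metis image_eqI)
  qed (use c in auto)
  moreover have "xmon (l + evar i - evar j) \<in> carrier ?R"
    if "l \<in> expos n" "i \<in> {1..n}" for l i j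
  proof (rule xmon_carrier)
    have "keys (l + evar i - evar j) \<subseteq> insert i (keys l)"
      by (auto simp: in_keys_iff lookup_minus lookup_add lookup_single when_def
          split: if_splits)
    then show "l + evar i - evar j \<in> expos n"
      using that by (auto simp: expos_def)
  qed
  ultimately show ?thesis
    unfolding sym_strongly_shifted_def P_of_def Pn_def by blast
qed

lemma sym_strongly_shifted_Inter:
  fixes F :: "('k::field) mpol set set"
  assumes "F \<noteq> {}" and F: "\<And>I. I \<in> F \<Longrightarrow> sym_strongly_shifted n I"
  shows "sym_strongly_shifted n (\<Inter>F)"
proof -
  have id: "ideal I (poly_ring n)" and mo: "\<forall>p\<in>I. \<forall>m\<in>keys p. xmon m \<in> I"
    and fixd: "\<And>s. s permutes {1..n} \<Longrightarrow> perm_poly s ` I = I" if "I \<in> F" for I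
    using F[OF that] by (simp_all add: sym_strongly_shifted_def monomial_ideal_iff sym_fixed_def)
  have "ideal (\<Inter>F) (poly_ring n)"
    by (rule ring.i_Intersect[OF ring_poly_ring id \<open>F \<noteq> {}\<close>])
  moreover have "\<forall>p\<in>\<Inter>F. \<forall>m\<in>keys p. xmon m \<in> \<Inter>F"
    using mo by auto
  ultimately have "monomial_ideal n (\<Inter>F)"
    unfolding monomial_ideal_iff by simp
  moreover have "sym_fixed n (\<Inter>F)"
    unfolding sym_fixed_def
  proof (intro allI impI equalityI subsetI)
    fix s p assume s: "s permutes {1..n}"
    have inv: "perm_poly t q \<in> \<Inter>F" if "q \<in> \<Inter>F" and t: "t permutes {1..n}" for t q
    proof
      fix I assume "I \<in> F"
      then show "perm_poly t q \<in> I" using fixd[OF _ t, of I] that(1) by auto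
    qed
    show "p \<in> \<Inter>F" if "p \<in> perm_poly s ` \<Inter>F"
    proof -
      obtain q where "q \<in> \<Inter>F" "p = perm_poly s q" using \<open>p \<in> perm_poly s ` \<Inter>F\<close> by (rule imageE)
      then show ?thesis using inv[OF _ s] by simp
    qed
    show "p \<in> perm_poly s ` \<Inter>F" if "p \<in> \<Inter>F"
      using inv[OF that permutes_inv[OF s]]
      by (intro image_eqI[where f = "perm_poly s"]) (simp_all only: perm_poly_inv[OF s])
  qed
  moreover have "xmon (l + evar i - evar j) \<in> \<Inter>F"
    if "l \<in> P_of n (\<Inter>F)" "i \<in> {1..n}" "j \<in> {1..n}" "i < j" "lookup l i < lookup l j" for l i j
  proof
    fix I assume I: "I \<in> F"
    then have "l \<in> P_of n I" using that(1) by (simp add: P_of_def)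
    then show "xmon (l + evar i - evar j) \<in> I"
      using F[OF I] that unfolding sym_strongly_shifted_def by blast
  qed
  ultimately show ?thesis
    unfolding sym_strongly_shifted_def by blast
qed

lemma Sss_least:
  fixes I :: "('k::field) mpol set"
  shows "B \<subseteq> expos n \<Longrightarrow> sym_strongly_shifted n (Sss n B :: 'k mpol set)"
    and "xmon ` B \<subseteq> (Sss n B :: 'k mpol set)"
    and "sym_strongly_shifted n I \<Longrightarrow> xmon ` B \<subseteq> I \<Longrightarrow> Sss n B \<subseteq> I"
proof -
  assume B: "B \<subseteq> expos n"
  show "sym_strongly_shifted n (Sss n B :: 'k mpol set)"
    unfolding Sss_def
  proof (rule sym_strongly_shifted_Inter)
    have "carrier (poly_ring n :: 'k mpol ring) \<in> {I. sym_strongly_shifted n I \<and> xmon ` B \<subseteq> I}"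
      using sym_strongly_shifted_carrier xmon_carrier B by blast
    then show "{I :: 'k mpol set. sym_strongly_shifted n I \<and> xmon ` B \<subseteq> I} \<noteq> {}" by blast
  qed auto
qed (auto simp: Sss_def)

end

theory Submission
  imports Defs
begin

text \<open>
  If at most one part of \<open>l\<close> lies strictly between its smallest part \<open>a\<close> and its largest part
  \<open>c\<close>, then the minimal generators of \<open>Sss n {l}\<close> are all monomials of degree \<open>|l|\<close> with
  exponents in \<open>{a..c}\<close>, and exchanges between two of those stay inside this set. Otherwise there
  are indices \<open>i \<noteq> j\<close> with \<open>a < l\<^sub>i \<le> l\<^sub>j < c\<close>. Swapping \<open>l\<^sub>i\<close> with a smallest part and \<open>l\<^sub>j\<close>
  with a largest one gives a generator \<open>v\<close> with \<open>l\<^sub>i > v\<^sub>i\<close> and \<open>l\<^sub>j < v\<^sub>j\<close>, but the exchange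
  \<open>l + e\<^sub>j - e\<^sub>i\<close> has too small a sum over the parts below \<open>l\<^sub>i\<close> together with \<open>i\<close>: the
  sum of the \<open>k\<close> smallest parts of a generator never drops below that of \<open>l\<close>.
\<close>

(* The exponent 1 in evar must not become Suc 0, else lookup_shift no longer matches. *)
declare One_nat_def [simp del]

section \<open>Monomial ideals described by exponent vectors\<close>

text \<open>For \<open>W\<close> inside \<open>expos n\<close> this is the ideal generated by the
  monomials of \<open>W\<close>, phrased through divisibility so that membership is read off from
  exponents.\<close>

definition up_ideal :: "nat \<Rightarrow> expo set \<Rightarrow> ('k::field) mpol set" where
  "up_ideal n W = {p \<in> carrier (poly_ring n). \<forall>m\<in>keys p. \<exists>w\<in>W. \<forall>i. lookup w i \<le> lookup m i}"

lemma xmon_up_ideal_iff: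
  "(xmon m :: ('k::field) mpol) \<in> up_ideal n W \<longleftrightarrow>
     m \<in> expos n \<and> (\<exists>w\<in>W. \<forall>i. lookup w i \<le> lookup m i)"
  by (auto simp: up_ideal_def xmon_def poly_ring_def)

lemma lookup_outside: "m \<in> expos n \<Longrightarrow> i \<notin> {1..n} \<Longrightarrow> lookup m i = 0"
  by (auto simp: expos_def in_keys_iff)

lemma expos_iff: "m \<in> expos n \<longleftrightarrow> (\<forall>i. i \<notin> {1..n} \<longrightarrow> lookup m i = 0)"
  by (auto simp: expos_def in_keys_iff)

lemma perm_expo_expos:
  assumes "s permutes {1..n}" "m \<in> expos n"
  shows "perm_expo s m \<in> expos n"
  using assms(2) permutes_in_image[OF permutes_inv[OF assms(1)]]
  unfolding expos_iff lookup_perm_expo[OF assms(1)] by blast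

lemma perm_poly_xmon:
  assumes "s permutes {1..n}"
  shows "perm_poly s (xmon m :: ('k::field) mpol) = xmon (perm_expo s m)"
  by (simp add: perm_poly_def xmon_def)

lemma sum_perm_expo:
  assumes "s permutes {1..n}"
  shows "sum (lookup (perm_expo s m)) T = sum (lookup m) (inv_into UNIV s ` T)"
proof -
  have "inj_on (inv_into UNIV s) T"
    using permutes_inj[OF permutes_inv[OF assms]] inj_on_subset by blast
  then show ?thesis
    by (simp add: sum.reindex lookup_perm_expo[OF assms])
qed

lemma lookup_shift:
  assumes "i \<noteq> j"
  shows "lookup (m + evar i - evar j) k =
    (if k = i then lookup m i + 1 else if k = j then lookup m j - 1 else lookup m k)"
  using assms by (simp add: lookup_minus lookup_add lookup_single when_def)

lemma shift_expos:
  assumes "m \<in> expos n" "i \<in> {1..n}"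
  shows "m + evar i - evar j \<in> expos n"
  using assms by (auto simp: expos_iff lookup_minus lookup_add lookup_single when_def)

lemma sum_remove2:
  assumes "i \<noteq> j" "finite T" "i \<in> T" "j \<in> T"
  shows "sum f T = f i + f j + sum f (T - {i,j})"
proof -
  have "sum f (T - {i}) = f j + sum f (T - {i} - {j})"
    using assms by (intro sum.remove) auto
  moreover have "T - {i} - {j} = T - {i,j}" by blast
  ultimately show ?thesis
    using sum.remove[of T i f] assms by (simp add: add.assoc)
qed

lemma sum_shift:
  assumes "i \<noteq> j" "finite T" "i \<in> T" "j \<in> T" "0 < lookup m j"
  shows "sum (lookup (m + evar i - evar j)) T = sum (lookup m) T"
proof -
  have "sum (lookup (m + evar i - evar j)) (T - {i,j}) = sum (lookup m) (T - {i,j})"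
    by (rule sum.cong) (auto simp: lookup_shift[OF assms(1)])
  then show ?thesis
    using assms(1,5) by (simp add: sum_remove2[OF assms(1-4)] lookup_shift[OF assms(1)])
qed

text \<open>By minimality of \<open>Sss\<close>, the ideals obtained here bound it from above, with
  the closure conditions checked on generators only.\<close>

lemma sym_strongly_shifted_up_ideal:
  assumes W: "W \<subseteq> expos n"
    and perm: "\<And>s w. s permutes {1..n} \<Longrightarrow> w \<in> W \<Longrightarrow> perm_expo s w \<in> W"
    and shift: "\<And>w i j. w \<in> W \<Longrightarrow> i \<in> {1..n} \<Longrightarrow> j \<in> {1..n} \<Longrightarrow>
      lookup w i < lookup w j \<Longrightarrow> w + evar i - evar j \<in> W"
  shows "sym_strongly_shifted n (up_ideal n W :: ('k::field) mpol set)"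
  unfolding sym_strongly_shifted_def
proof (intro conjI ballI impI)
  let ?J = "up_ideal n W :: 'k mpol set"
  have "ideal ?J (poly_ring n)"
    unfolding ideal_poly_ring_iff
  proof (intro conjI ballI)
    show "?J \<subseteq> carrier (poly_ring n)" "0 \<in> ?J" by (auto simp: up_ideal_def poly_ring_def)
  next
    fix p q assume pq: "p \<in> ?J" "q \<in> ?J"
    have "m \<in> expos n \<and> (\<exists>w\<in>W. \<forall>i. lookup w i \<le> lookup m i)" if "m \<in> keys (p + q)" for m
    proof -
      have "m \<in> keys p \<or> m \<in> keys q" using that keys_add[of p q] by blast
      then show ?thesis using pq by (auto simp: up_ideal_def poly_ring_def)
    qed
    then show "p + q \<in> ?J" by (auto simp: up_ideal_def poly_ring_def)
  next
    fix r p :: "'k mpol" assume r: "r \<in> carrier (poly_ring n)" and p: "p \<in> ?J"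
    have "\<exists>w\<in>W. \<forall>i. lookup w i \<le> lookup m i" if m: "m \<in> keys (r * p)" for m
    proof -
      obtain a b where ab: "m = a + b" "b \<in> keys p"
        using m keys_mult[of r p] by auto
      then obtain w where "w \<in> W" "\<forall>i. lookup w i \<le> lookup b i"
        using p by (auto simp: up_ideal_def)
      then show ?thesis using ab by (auto simp: lookup_add intro!: bexI[of _ w] trans_le_add2)
    qed
    then show "r * p \<in> ?J"
      using r p carrier_mult[of r n p] by (auto simp: up_ideal_def poly_ring_def)
  qed
  moreover have "xmon m \<in> ?J" if "p \<in> ?J" "m \<in> keys p" for p m
    using that by (auto simp: xmon_up_ideal_iff) (auto simp: up_ideal_def poly_ring_def)
  ultimately show "monomial_ideal n ?J"
    unfolding monomial_ideal_iff by blast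
  have inv: "perm_poly s p \<in> ?J" if s: "s permutes {1..n}" and p: "p \<in> ?J" for s p
  proof -
    have "m \<in> expos n \<and> (\<exists>w\<in>W. \<forall>i. lookup w i \<le> lookup m i)"
      if m: "m \<in> keys (perm_poly s p)" for m
    proof -
      let ?m = "perm_expo (inv_into UNIV s) m"
      have k: "?m \<in> keys p"
        using m by (simp add: in_keys_iff lookup_perm_poly[OF s])
      then have "?m \<in> expos n" using p by (auto simp: up_ideal_def poly_ring_def)
      then have "m \<in> expos n"
        using perm_expo_expos[OF s] perm_expo_inv(2)[OF s] by metis
      moreover obtain w where w: "w \<in> W" "\<And>i. lookup w i \<le> lookup ?m i"
        using p k by (auto simp: up_ideal_def)
      have "lookup (perm_expo s w) i \<le> lookup m i" for i
      proof -
        have "lookup (perm_expo s w) i \<le> lookup (perm_expo s ?m) i"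
          using w(2) by (simp only: lookup_perm_expo[OF s])
        then show ?thesis by (simp add: perm_expo_inv[OF s])
      qed
      then have "\<exists>w\<in>W. \<forall>i. lookup w i \<le> lookup m i" using perm[OF s w(1)] by blast
      ultimately show ?thesis by blast
    qed
    then show ?thesis by (auto simp: up_ideal_def poly_ring_def)
  qed
  show "sym_fixed n ?J"
    unfolding sym_fixed_def
  proof (intro allI impI equalityI subsetI)
    fix s p assume s: "s permutes {1..n}" and p: "p \<in> ?J"
    show "p \<in> perm_poly s ` ?J"
      using inv[OF permutes_inv[OF s] p] perm_poly_inv[OF s, of p] by (metis image_eqI)
  qed (use inv in auto)
next
  fix m i j
  assume m: "m \<in> P_of n (up_ideal n W :: 'k mpol set)"
    and ij: "i \<in> {1..n}" "j \<in> {1..n}" "i < j" "lookup m i < lookup m j"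
  then obtain w where w: "w \<in> W" "\<And>k. lookup w k \<le> lookup m k" and me: "m \<in> expos n"
    by (auto simp: P_of_def xmon_up_ideal_iff)
  have ne: "i \<noteq> j" using ij by auto
  have "\<exists>w\<in>W. \<forall>k. lookup w k \<le> lookup (m + evar i - evar j) k"
  \<comment> \<open>\<open>w\<close> still divides the shifted monomial unless its entry at
    \<open>j\<close> equals that of \<open>m\<close>; in that case \<open>w\<close> can be shifted
    along.\<close>
  proof (cases "lookup w j < lookup m j")
    case True
    then have "lookup w k \<le> lookup (m + evar i - evar j) k" for k
      using w(2)[of k] by (auto simp: lookup_shift[OF ne])
    then show ?thesis using w(1) by blast
  next
    case False
    then have "lookup w i < lookup w j" using ij(4) w(2)[of i] by linarith
    moreover have "lookup (w + evar i - evar j) k \<le> lookup (m + evar i - evar j) k" for k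
      using w(2)[of k] by (auto simp: lookup_shift[OF ne])
    ultimately show ?thesis using shift[OF w(1) ij(1,2)] by blast
  qed
  then show "xmon (m + evar i - evar j) \<in> (up_ideal n W :: 'k mpol set)"
    using shift_expos[OF me ij(1)] by (simp add: xmon_up_ideal_iff)
qed

section \<open>Permuting, sorting and shifting inside a given ideal\<close>

lemma xmon_perm_expo_mem:
  fixes I :: "('k::field) mpol set"
  assumes "sym_strongly_shifted n I" "s permutes {1..n}" "xmon m \<in> I"
  shows "xmon (perm_expo s m) \<in> I"
proof -
  have "perm_poly s ` I = I"
    using assms by (auto simp: sym_strongly_shifted_def sym_fixed_def)
  then show ?thesis
    using assms(3) perm_poly_xmon[OF assms(2)] by (metis image_eqI)
qed

lemma ex_sorting_perm:
  fixes f :: "nat \<Rightarrow> 'a::linorder"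
  obtains s where "s permutes {1..n}"
    "\<And>i j. i \<in> {1..n} \<Longrightarrow> j \<in> {1..n} \<Longrightarrow> i \<le> j \<Longrightarrow> f (s i) \<le> f (s j)"
proof -
  define xs where "xs = sort_key f [1..<Suc n]"
  have d: "distinct xs" and st: "set xs = {1..n}" and len: "length xs = n"
    by (auto simp: xs_def)
  \<comment> \<open>List positions start at 0, indices at 1; outside the range \<open>s\<close> is
    the identity, as \<open>permutes\<close> demands.\<close>
  define s where "s i = (if i \<in> {1..n} then xs ! (i - 1) else i)" for i
  have "bij_betw (\<lambda>i. i - 1) {1..n} {..<n}"
    by (rule bij_betw_byWitness[where f' = Suc]) auto
  moreover have "bij_betw ((!) xs) {..<n} {1..n}"
    using bij_betw_nth[OF d _ st[symmetric]] len by auto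
  ultimately have "bij_betw ((!) xs \<circ> (\<lambda>i. i - 1)) {1..n} {1..n}"
    by (rule bij_betw_trans)
  then have "bij_betw s {1..n} {1..n}"
    by (rule bij_betw_cong[THEN iffD1, rotated]) (auto simp: s_def)
  then have "s permutes {1..n}"
    by (rule bij_imp_permutes) (auto simp: s_def)
  moreover have "f (s i) \<le> f (s j)" if "i \<in> {1..n}" "j \<in> {1..n}" "i \<le> j" for i j
  proof -
    have "sorted (map f xs)" by (simp add: xs_def)
    then have "map f xs ! (i - 1) \<le> map f xs ! (j - 1)"
      by (rule sorted_nth_mono) (use that len in auto)
    then show ?thesis using that len by (auto simp: s_def)
  qed
  ultimately show thesis by (rule that)
qed

text \<open>Unlike in the definition, \<open>m\<close> need not be sorted and \<open>i\<close> need not precede \<open>j\<close>.\<close>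

lemma xmon_shift_mem:
  fixes I :: "('k::field) mpol set"
  assumes I: "sym_strongly_shifted n I"
    and m: "m \<in> expos n" "xmon m \<in> I"
    and ij: "i \<in> {1..n}" "j \<in> {1..n}" "lookup m i < lookup m j"
  shows "xmon (m + evar i - evar j) \<in> I"
proof -
  obtain s where s: "s permutes {1..n}"
    and mono: "\<And>i j. i \<in> {1..n} \<Longrightarrow> j \<in> {1..n} \<Longrightarrow> i \<le> j \<Longrightarrow> lookup m (s i) \<le> lookup m (s j)"
    using ex_sorting_perm[of n "lookup m"] by blast
  \<comment> \<open>\<open>perm_expo t\<close> reads entry \<open>s k\<close> at place
    \<open>k\<close>, so it sorts \<open>m\<close>. The definition is applied to the sorted vector
    and the result carried back by \<open>s\<close>.\<close>
  define t where "t = inv_into UNIV s"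
  have t: "t permutes {1..n}" unfolding t_def by (rule permutes_inv[OF s])
  have tinv: "inv_into UNIV t = s" unfolding t_def using s by (rule permutes_inv_inv)
  have lk: "lookup (perm_expo t x) k = lookup x (s k)" for x k
    by (simp add: lookup_perm_expo[OF t] tinv)
  have st: "s (t k) = k" for k unfolding t_def using s by (simp add: permutes_inverses)
  have tij: "t i \<in> {1..n}" "t j \<in> {1..n}" using ij permutes_in_image[OF t] by auto
  have lt: "t i < t j"
  proof (rule ccontr)
    assume "\<not> t i < t j"
    then show False using mono[of "t j" "t i"] tij ij(3) by (simp add: st)
  qed
  have "perm_expo t m \<in> P_of n I"
    using mono perm_expo_expos[OF t m(1)] xmon_perm_expo_mem[OF I t m(2)]
    by (auto simp: P_of_def Pn_def lk)
  then have "xmon (perm_expo t m + evar (t i) - evar (t j)) \<in> I"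
    using I tij lt ij(3) by (simp add: sym_strongly_shifted_def lk st)
  then have "xmon (perm_expo s (perm_expo t m + evar (t i) - evar (t j))) \<in> I"
    by (rule xmon_perm_expo_mem[OF I s])
  moreover have "perm_expo s (perm_expo t m + evar (t i) - evar (t j)) = m + evar i - evar j"
  proof (rule poly_mapping_eqI)
    fix k
    have ne: "i \<noteq> j" "t i \<noteq> t j" using ij lt by auto
    have "t k = t x \<longleftrightarrow> k = x" for x using permutes_inj[OF t] by (auto dest: injD)
    then show "lookup (perm_expo s (perm_expo t m + evar (t i) - evar (t j))) k
        = lookup (m + evar i - evar j) k"
      by (simp add: lookup_perm_expo[OF s] t_def[symmetric] lookup_shift ne lk st)
  qed
  ultimately show ?thesis by simp
qed

text \<open>Any strict inequality between entries would make the degree of \<open>m\<close> larger.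
  Minimal generators are identified in this way.\<close>

lemma eq_of_le_of_sum_le:
  assumes "w \<in> expos n" "m \<in> expos n" "\<And>i. lookup w i \<le> lookup m i"
    "sum (lookup m) {1..n} \<le> sum (lookup w) {1..n}"
  shows "w = m"
proof (rule poly_mapping_eqI)
  fix i
  have eq: "sum (lookup w) {1..n} = sum (lookup m) {1..n}"
    using assms(4) sum_mono[of "{1..n}" "lookup w" "lookup m"] assms(3) by force
  show "lookup w i = lookup m i"
    using sum_mono_inv[OF eq assms(3), of i] lookup_outside[OF assms(1), of i]
      lookup_outside[OF assms(2), of i] by (cases "i \<in> {1..n}") auto
qed

section \<open>Sufficiency: bounds on degree and exponents\<close>

text \<open>Apart from the common factor \<open>(x_1...x_n)^a\<close>, these are the generators of
  an ideal of Veronese type.\<close>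

definition box :: "nat \<Rightarrow> nat \<Rightarrow> nat \<Rightarrow> nat \<Rightarrow> expo set" where
  "box n d a c = {w \<in> expos n. sum (lookup w) {1..n} = d \<and> (\<forall>i\<in>{1..n}. a \<le> lookup w i \<and> lookup w i \<le> c)}"

lemma perm_expo_box:
  assumes s: "s permutes {1..n}" and "w \<in> box n d a c"
  shows "perm_expo s w \<in> box n d a c"
  using assms(2) perm_expo_expos[OF s] permutes_in_image[OF permutes_inv[OF s]]
    sum_perm_expo[OF s, of w "{1..n}"] permutes_image[OF permutes_inv[OF s]]
  by (simp add: box_def lookup_perm_expo[OF s])

lemma shift_box:
  assumes "w \<in> box n d a c" "i \<in> {1..n}" "j \<in> {1..n}" "i \<noteq> j" "lookup w i < c" "a < lookup w j"
  shows "w + evar i - evar j \<in> box n d a c"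
  using assms shift_expos[of w n i j] sum_shift[of i j "{1..n}" w]
  by (auto simp: box_def lookup_shift)

lemma xmon_box_mem:
  fixes I :: "('k::field) mpol set"
  assumes I: "sym_strongly_shifted n I"
    and l: "l \<in> box n d a c" "xmon l \<in> I"
    and C: "\<And>i j. i \<in> {1..n} \<Longrightarrow> j \<in> {1..n} \<Longrightarrow> i \<noteq> j \<Longrightarrow> a < lookup l i \<Longrightarrow> lookup l j < c \<Longrightarrow>
      lookup l j < lookup l i"
    and u: "u \<in> box n d a c"
  shows "xmon u \<in> I"
  using u
  \<comment> \<open>Induction on the \<open>L\<^sup>1\<close> distance to \<open>l\<close>: choose \<open>u\<^sub>i < l\<^sub>i\<close> and \<open>u\<^sub>j > l\<^sub>j\<close>. If \<open>u\<^sub>j \<le> u\<^sub>i\<close>, then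
    \<open>u\<close> is a shift of the closer \<open>u + e\<^sub>i - e\<^sub>j\<close>; if not, swapping the entries \<open>i\<close> and \<open>j\<close> of \<open>u\<close>
    brings it closer, because \<open>l\<^sub>j < l\<^sub>i\<close>.\<close>
proof (induction "\<Sum>k\<in>{1..n}. nat \<bar>int (lookup u k) - int (lookup l k)\<bar>" arbitrary: u rule: less_induct)
  case less
  let ?D = "\<lambda>u. \<Sum>k\<in>{1..n}. nat \<bar>int (lookup u k) - int (lookup l k)\<bar>"
  show ?case
  proof (cases "u = l")
    case False
    have sums: "sum (lookup u) {1..n} = sum (lookup l) {1..n}"
      using less.prems l(1) by (simp add: box_def)
    \<comment> \<open>Otherwise \<open>y\<close> divides \<open>x\<close>, and equal degrees force
      equality. Used in both directions, this supplies \<open>i\<close> and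
      \<open>j\<close>.\<close>
    have ex: "\<exists>i\<in>{1..n}. lookup x i < lookup y i"
      if "x \<noteq> y" "x \<in> expos n" "y \<in> expos n" "sum (lookup x) {1..n} = sum (lookup y) {1..n}" for x y
    proof (rule ccontr)
      assume "\<not> ?thesis"
      then have ge: "lookup y i \<le> lookup x i" for i
        using lookup_outside[OF \<open>y \<in> expos n\<close>, of i] by (cases "i \<in> {1..n}") force+
      have "y = x" using that(2-4) ge by (intro eq_of_le_of_sum_le[of y n x]) auto
      then show False using that(1) by simp
    qed
    have ue: "u \<in> expos n" and le: "l \<in> expos n" using less.prems l(1) by (auto simp: box_def)
    obtain i where i: "i \<in> {1..n}" "lookup u i < lookup l i"
      using ex[OF False ue le sums] by blast
    obtain j where j: "j \<in> {1..n}" "lookup l j < lookup u j"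
      using ex[OF False[symmetric] le ue sums[symmetric]] by blast
    have ne: "i \<noteq> j" using i j by auto
    have bds: "a \<le> lookup u i" "lookup u j \<le> c" "lookup l i \<le> c" "a \<le> lookup l j"
      using less.prems l(1) i j by (auto simp: box_def)
    \<comment> \<open>The bounds on \<open>u\<close> put \<open>l\<close> above \<open>a\<close> at
      \<open>i\<close> and below \<open>c\<close> at \<open>j\<close>, as \<open>C\<close>
      requires.\<close>
    have lij: "lookup l j < lookup l i"
      using C[OF i(1) j(1) ne] i j bds by linarith
    have dec: "?D x < ?D u" if "\<And>k. k \<noteq> i \<Longrightarrow> k \<noteq> j \<Longrightarrow> lookup x k = lookup u k"
      "nat \<bar>int (lookup x i) - int (lookup l i)\<bar> + nat \<bar>int (lookup x j) - int (lookup l j)\<bar>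
       < nat \<bar>int (lookup u i) - int (lookup l i)\<bar> + nat \<bar>int (lookup u j) - int (lookup l j)\<bar>" for x
    proof -
      have "(\<Sum>k\<in>{1..n}-{i,j}. nat \<bar>int (lookup x k) - int (lookup l k)\<bar>)
          = (\<Sum>k\<in>{1..n}-{i,j}. nat \<bar>int (lookup u k) - int (lookup l k)\<bar>)"
        by (rule sum.cong) (use that(1) in auto)
      then show ?thesis
        using that(2) unfolding sum_remove2[OF ne finite_atLeastAtMost i(1) j(1)]
        by (simp only: add_less_cancel_right)
    qed
    show ?thesis
    proof (cases "lookup u j \<le> lookup u i")
      case True
      let ?x = "u + evar i - evar j"
      have xb: "?x \<in> box n d a c"
        using shift_box[OF less.prems i(1) j(1) ne] i j bds by linarith
      have "xmon ?x \<in> I"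
        by (rule less.hyps[OF dec xb]) (use i j ne in \<open>auto simp: lookup_shift[OF ne]\<close>)
      have "xmon (?x + evar j - evar i) \<in> I"
      proof (rule xmon_shift_mem[OF I _ \<open>xmon ?x \<in> I\<close> j(1) i(1)])
        show "?x \<in> expos n" using xb by (simp add: box_def)
        show "lookup ?x j < lookup ?x i" using j True ne by (simp add: lookup_shift[OF ne])
      qed
      moreover have "?x + evar j - evar i = u"
        using j ne by (intro poly_mapping_eqI) (auto simp: lookup_minus lookup_add lookup_single when_def)
      ultimately show ?thesis by simp
    next
      case False
      let ?s = "transpose i j"
      let ?x = "perm_expo ?s u"
      have s: "?s permutes {1..n}" using i j by (intro permutes_swap_id)
      have lk: "lookup ?x k = lookup u (?s k)" for k
        by (simp add: lookup_perm_expo[OF s])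
      have "xmon ?x \<in> I"
        by (rule less.hyps[OF dec perm_expo_box[OF s less.prems]])
          (use i j ne lij False in \<open>auto simp: lk transpose_def\<close>)
      then have "xmon (perm_expo ?s ?x) \<in> I"
        by (rule xmon_perm_expo_mem[OF I s])
      moreover have "perm_expo ?s ?x = u"
        using perm_expo_inv(1)[OF s, of u] by simp
      ultimately show ?thesis by simp
    qed
  qed (use l in simp)
qed

text \<open>\<open>I\<close> is squeezed between the box and \<open>up_ideal\<close> of the box, so
  its minimal generators lie in the box. Under \<open>bd\<close>, condition \<open>C\<close> means
  that at most one part is strictly between \<open>a\<close> and \<open>c\<close>: two such parts
  would each have to exceed the other.\<close>

lemma strong_exchange_if:
  fixes I :: "('k::field) mpol set"
  assumes l: "l \<in> expos n" and I: "I = Sss n {l}"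
    and bd: "\<And>i. i \<in> {1..n} \<Longrightarrow> a \<le> lookup l i \<and> lookup l i \<le> c"
    and C: "\<And>i j. i \<in> {1..n} \<Longrightarrow> j \<in> {1..n} \<Longrightarrow> i \<noteq> j \<Longrightarrow> a < lookup l i \<Longrightarrow> lookup l j < c \<Longrightarrow>
      lookup l j < lookup l i"
  shows "strong_exchange n I"
proof -
  define d where "d = sum (lookup l) {1..n}"
  let ?B = "box n d a c"
  have lB: "l \<in> ?B" using l bd by (simp add: box_def d_def)
  have sI: "sym_strongly_shifted n I" unfolding I using l by (intro Sss_least) auto
  have lI: "xmon l \<in> I" using Sss_least(2)[of "{l}" n] I by auto
  have BI: "xmon u \<in> I" if "u \<in> ?B" for u
    by (rule xmon_box_mem[OF sI lB lI C that])
  have "sym_strongly_shifted n (up_ideal n ?B :: 'k mpol set)"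
  proof (rule sym_strongly_shifted_up_ideal)
    fix w i j assume w: "w \<in> ?B" and ij: "i \<in> {1..n}" "j \<in> {1..n}" "lookup w i < lookup w j"
    then have "a \<le> lookup w i" "lookup w j \<le> c" by (auto simp: box_def)
    then show "w + evar i - evar j \<in> ?B" using ij by (intro shift_box[OF w]) auto
  next
    show "?B \<subseteq> expos n" by (auto simp: box_def)
  qed (rule perm_expo_box)
  then have IU: "I \<subseteq> up_ideal n ?B"
    unfolding I using lB l by (intro Sss_least) (auto simp: xmon_up_ideal_iff)
  have gens: "u \<in> ?B" if u: "u \<in> min_gens n I" for u
  proof -
    have "(xmon u :: 'k mpol) \<in> up_ideal n ?B" using u IU by (auto simp: min_gens_def)
    then obtain w where w: "w \<in> ?B" "\<forall>i. lookup w i \<le> lookup u i"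
      by (auto simp: xmon_up_ideal_iff)
    moreover have "w = u" using u w BI[OF w(1)] by (auto simp: min_gens_def box_def)
    ultimately show ?thesis by simp
  qed
  show ?thesis
    unfolding strong_exchange_def
  proof (intro ballI impI, elim conjE)
    fix u v i j assume uv: "u \<in> min_gens n I" "v \<in> min_gens n I"
      and ij: "i \<in> {1..n}" "j \<in> {1..n}" "lookup u i > lookup v i" "lookup u j < lookup v j"
    \<comment> \<open>The entries of \<open>v\<close> certify that \<open>u\<close> exceeds
      \<open>a\<close> at \<open>i\<close> and is below \<open>c\<close> at \<open>j\<close>, so one
      unit can be moved.\<close>
    have "a \<le> lookup v i" "lookup v j \<le> c" using gens[OF uv(2)] ij by (auto simp: box_def)
    then have "u + evar j - evar i \<in> ?B" using ij by (intro shift_box[OF gens[OF uv(1)]]) auto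
    then show "xmon (u + evar j - evar i) \<in> I" by (rule BI)
  qed
qed

section \<open>Necessity: sums of the smallest parts\<close>

lemma strong_exchange_only_if:
  fixes I :: "('k::field) mpol set"
  assumes l: "l \<in> expos n" and I: "I = Sss n {l}"
    and mem: "p \<in> {1..n}" "i \<in> {1..n}" "j \<in> {1..n}" "q \<in> {1..n}" and ij: "i \<noteq> j"
    and lt: "lookup l p < lookup l i" "lookup l i \<le> lookup l j" "lookup l j < lookup l q"
  shows "\<not> strong_exchange n I"
proof
  assume ex: "strong_exchange n I"
  \<comment> \<open>\<open>T\<close> carries the smallest parts of \<open>l\<close>. Among the ties
    at the value of \<open>l\<close> at \<open>i\<close> only \<open>i\<close> is taken, so
    \<open>j\<close> stays outside even if both parts are equal.\<close>
  define T where "T = insert i {k \<in> {1..n}. lookup l k < lookup l i}"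
  define d where "d = sum (lookup l) {1..n}"
  \<comment> \<open>Ranging over all \<open>S\<close> of the size of \<open>T\<close> makes the
    bound invariant under permutations without sorting.\<close>
  define W where "W = {w \<in> expos n. sum (lookup w) {1..n} = d \<and>
     (\<forall>S\<subseteq>{1..n}. card S = card T \<longrightarrow> sum (lookup l) T \<le> sum (lookup w) S)}"
  have T: "finite T" "T \<subseteq> {1..n}" "i \<in> T" "j \<notin> T" using mem ij lt by (auto simp: T_def)
  have "sum (lookup l) T \<le> sum (lookup l) S" if S: "S \<subseteq> {1..n}" "card S = card T" for S
  proof -
    have fS: "finite S" using S(1) finite_subset by blast
    \<comment> \<open>The parts on \<open>T - S\<close> are at most that at \<open>i\<close>, those
      on \<open>S - T\<close> at least that, and the two sets have equal size.\<close>
    have c: "card (S - T) = card (T - S)"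
      using fS T(1) S(2) by (simp add: card_Diff_subset_Int Int_commute)
    have "sum (lookup l) (T - S) \<le> of_nat (card (T - S)) * lookup l i"
      by (rule sum_bounded_above) (auto simp: T_def)
    also have "\<dots> = of_nat (card (S - T)) * lookup l i" using c by simp
    also have "\<dots> \<le> sum (lookup l) (S - T)"
      by (rule sum_bounded_below) (use S(1) in \<open>auto simp: T_def\<close>)
    finally show ?thesis
      using sum.Int_Diff[OF T(1), of "lookup l" S] sum.Int_Diff[OF fS, of "lookup l" T]
      by (simp add: Int_commute)
  qed
  then have lW: "l \<in> W" using l by (simp add: W_def d_def)
  have "sym_strongly_shifted n (up_ideal n W :: 'k mpol set)"
  proof (rule sym_strongly_shifted_up_ideal)
    fix s w assume s: "s permutes {1..n}" and w: "w \<in> W"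
    have t: "inv_into UNIV s permutes {1..n}" by (rule permutes_inv[OF s])
    have "sum (lookup l) T \<le> sum (lookup (perm_expo s w)) S"
      if "S \<subseteq> {1..n}" "card S = card T" for S
    proof -
      have "inv_into UNIV s ` S \<subseteq> {1..n}" using permutes_image[OF t] that(1) by blast
      moreover have "card (inv_into UNIV s ` S) = card T"
        using that(2) permutes_inj_on[OF t] by (simp add: card_image)
      ultimately show ?thesis using w by (simp add: W_def sum_perm_expo[OF s])
    qed
    then show "perm_expo s w \<in> W"
      using w perm_expo_expos[OF s] sum_perm_expo[OF s, of w "{1..n}"] permutes_image[OF t]
      by (simp add: W_def)
  next
    fix w x y assume w: "w \<in> W" and xy: "x \<in> {1..n}" "y \<in> {1..n}" "lookup w x < lookup w y"
    then have ne: "x \<noteq> y" by auto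
    have "sum (lookup l) T \<le> sum (lookup (w + evar x - evar y)) S"
      if S: "S \<subseteq> {1..n}" "card S = card T" for S
    \<comment> \<open>Only here does the shift lower the sum over \<open>S\<close>. Replacing
      \<open>y\<close> by \<open>x\<close> in \<open>S\<close> keeps its size, and the entry of
      \<open>w\<close> at \<open>x\<close> is at most the lowered entry at \<open>y\<close>.\<close>
    proof (cases "y \<in> S \<and> x \<notin> S")
      case True
      have fS: "finite S" using S(1) finite_subset by blast
      let ?S = "insert x (S - {y})"
      have "card ?S = Suc (card (S - {y}))"
        using True fS by (intro card_insert_disjoint) auto
      also have "\<dots> = card T" using card.remove[OF fS, of y] True S(2) by simp
      finally have "card ?S = card T" .
      moreover have "?S \<subseteq> {1..n}" using S(1) xy(1) by blast
      ultimately have "sum (lookup l) T \<le> sum (lookup w) ?S" using w unfolding W_def by blast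
      also have "\<dots> = lookup w x + sum (lookup w) (S - {y})" using True fS by simp
      also have "\<dots> \<le> (lookup w y - 1) + sum (lookup w) (S - {y})" using xy by simp
      also have "\<dots> = lookup (w + evar x - evar y) y + sum (lookup (w + evar x - evar y)) (S - {y})"
      proof -
        have "sum (lookup (w + evar x - evar y)) (S - {y}) = sum (lookup w) (S - {y})"
          by (rule sum.cong[OF refl]) (use True in \<open>auto simp: lookup_shift[OF ne]\<close>)
        then show ?thesis using ne by (simp add: lookup_shift[OF ne])
      qed
      also have "\<dots> = sum (lookup (w + evar x - evar y)) S"
        using True fS by (intro sum.remove[symmetric]) auto
      finally show ?thesis .
    next
      case False
      have fS: "finite S" using S(1) finite_subset by blast
      have "sum (lookup w) S \<le> sum (lookup (w + evar x - evar y)) S"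
      proof (cases "y \<in> S")
        case True
        then show ?thesis using False sum_shift[OF ne fS, of w] xy by simp
      next
        case y: False
        then show ?thesis by (intro sum_mono) (auto simp: lookup_shift[OF ne])
      qed
      then show ?thesis using w S by (auto simp: W_def intro: order_trans)
    qed
    moreover have "sum (lookup (w + evar x - evar y)) {1..n} = d"
      using sum_shift[OF ne, of "{1..n}" w] xy w by (simp add: W_def)
    ultimately show "w + evar x - evar y \<in> W"
      using w shift_expos[of w n x y] xy by (simp add: W_def)
  qed (auto simp: W_def)
  then have IU: "I \<subseteq> up_ideal n W"
    unfolding I using lW l by (intro Sss_least) (auto simp: xmon_up_ideal_iff)
  \<comment> \<open>A monomial of \<open>I\<close> is divisible by one of degree \<open>d\<close>
    from \<open>W\<close>; with degree at most \<open>d\<close> it must be equal to it.\<close>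
  have inW: "m \<in> W" if "xmon m \<in> I" "sum (lookup m) {1..n} \<le> d" for m
  proof -
    have "(xmon m :: 'k mpol) \<in> up_ideal n W" using that IU by blast
    then obtain w where w: "w \<in> W" "\<And>i. lookup w i \<le> lookup m i" and m: "m \<in> expos n"
      by (auto simp: xmon_up_ideal_iff)
    have "w = m" using w m that(2) by (intro eq_of_le_of_sum_le[of w n m]) (auto simp: W_def)
    then show ?thesis using w by simp
  qed
  have gens: "m \<in> min_gens n I" if m: "m \<in> expos n" "xmon m \<in> I" "sum (lookup m) {1..n} = d" for m
  proof -
    have "v = m" if v: "v \<in> expos n" "xmon v \<in> I" "\<forall>i. lookup v i \<le> lookup m i" for v
    proof -
      have "sum (lookup v) {1..n} \<le> d" unfolding m(3)[symmetric] using v(3) by (intro sum_mono) auto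
      then have "v \<in> W" using inW v by blast
      then show ?thesis using v m by (intro eq_of_le_of_sum_le[of v n m]) (auto simp: W_def)
    qed
    then show ?thesis using m by (auto simp: min_gens_def)
  qed
  have sI: "sym_strongly_shifted n I" unfolding I using l by (intro Sss_least) auto
  have lI: "xmon l \<in> I" using Sss_least(2)[of "{l}" n] I by auto
  \<comment> \<open>The four indices are distinct, so the two swaps are independent:
    \<open>?v\<close> has the part of \<open>p\<close> at \<open>i\<close> and that of
    \<open>q\<close> at \<open>j\<close>.\<close>
  let ?s = "transpose p i \<circ> transpose j q"
  have s: "?s permutes {1..n}" using mem by (intro permutes_compose permutes_swap_id)
  let ?v = "perm_expo ?s l"
  have vI: "xmon ?v \<in> I" by (rule xmon_perm_expo_mem[OF sI s lI])
  have vd: "sum (lookup ?v) {1..n} = d"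
    by (simp only: sum_perm_expo[OF s] permutes_image[OF permutes_inv[OF s]] d_def)
  have vg: "?v \<in> min_gens n I" by (rule gens[OF perm_expo_expos[OF s l] vI vd])
  have lg: "l \<in> min_gens n I" by (rule gens[OF l lI]) (simp add: d_def)
  have inv: "inv_into UNIV ?s = transpose j q \<circ> transpose p i"
    by (subst o_inv_distrib) auto
  have dist: "p \<noteq> i" "p \<noteq> j" "p \<noteq> q" "i \<noteq> q" "j \<noteq> q" using lt by auto
  have v: "lookup ?v i = lookup l p" "lookup ?v j = lookup l q"
    using dist ij by (simp_all add: lookup_perm_expo[OF s] inv transpose_def)
  have "l \<noteq> ?v" using v lt by auto
  then have "xmon (l + evar j - evar i) \<in> I"
    using ex lg vg mem v lt unfolding strong_exchange_def by auto
  moreover have "sum (lookup (l + evar j - evar i)) {1..n} = d"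
    using sum_shift[of j i "{1..n}" l] ij mem lt by (simp add: d_def)
  ultimately have "l + evar j - evar i \<in> W" by (intro inW) auto
  then have "sum (lookup l) T \<le> sum (lookup (l + evar j - evar i)) T"
    using T(2) by (simp add: W_def)
  \<comment> \<open>\<open>T\<close> contains \<open>i\<close>, which loses a unit, but not
    \<open>j\<close>, which gains it.\<close>
  moreover have "sum (lookup (l + evar j - evar i)) T < sum (lookup l) T"
    using T ij lt by (intro sum_strict_mono_ex1) (auto simp: lookup_shift[OF ij[symmetric]])
  ultimately show False by simp
qed

section \<open>Reading off the three types from a sorted vector\<close>

theorem proposition3p21:
  fixes n :: nat and l :: expo and I :: "('k::field) mpol set"
  assumes "l \<in> Pn n" and "l \<noteq> 0"
    and "I = Sss n {l}"
  shows "strong_exchange n I \<longleftrightarrow>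
     (\<exists>a. a \<noteq> 0 \<and> (\<forall>i\<in>{1..n}. lookup l i = a)) \<or>
     (\<exists>a b s. a < b \<and> 0 < s \<and> s \<le> n \<and>
        (\<forall>i\<in>{1..n}. lookup l i = (if i \<le> s then a else b))) \<or>
     (\<exists>a b c s. a < b \<and> b < c \<and> 0 < s \<and> s + 1 \<le> n \<and>
        (\<forall>i\<in>{1..n}. lookup l i = (if i \<le> s then a else if i = s + 1 then b else c)))"
    (is "_ \<longleftrightarrow> ?T1 \<or> ?T2 \<or> ?T3")
proof
  have l: "l \<in> expos n" using assms(1) by (simp add: Pn_def)
  have mono: "lookup l i \<le> lookup l j" if "i \<in> {1..n}" "j \<in> {1..n}" "i \<le> j" for i j
    using assms(1) that by (simp add: Pn_def)
  \<comment> \<open>This yields that \<open>n\<close> is positive and that the constant in the first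
    type is nonzero.\<close>
  have nz: "\<exists>i\<in>{1..n}. lookup l i \<noteq> 0"
  proof (rule ccontr)
    assume "\<not> ?thesis"
    then have "lookup l i = 0" for i using lookup_outside[OF l] by blast
    then have "l = 0" by (intro poly_mapping_eqI) simp
    then show False using assms(2) by simp
  qed
  then have n: "1 \<in> {1..n}" "n \<in> {1..n}" by auto
  define a c where "a = lookup l 1" and "c = lookup l n"
  have bd: "a \<le> lookup l i" "lookup l i \<le> c" if "i \<in> {1..n}" for i
    using that n by (auto simp: a_def c_def intro!: mono)
  show "?T1 \<or> ?T2 \<or> ?T3" if ex: "strong_exchange n I"
  proof (cases "a = c")
    case True
    then have "\<forall>i\<in>{1..n}. lookup l i = a" using bd by (metis order_antisym)
    then show ?thesis using nz by auto
  next
    case False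
    have mid: "x = y" if "x \<in> {1..n}" "y \<in> {1..n}" "a < lookup l x" "lookup l x < c"
      "a < lookup l y" "lookup l y < c" for x y
    proof (rule ccontr)
      assume "x \<noteq> y"
      \<comment> \<open>The smaller and larger parts needed are those at \<open>1\<close> and
        \<open>n\<close>; the order of the two middle parts is settled afterwards by
        symmetry.\<close>
      have main: False if "x \<in> {1..n}" "y \<in> {1..n}" "x \<noteq> y" "a < lookup l x"
        "lookup l x \<le> lookup l y" "lookup l y < c" for x y
        using strong_exchange_only_if[OF l assms(3) n(1) that(1,2) n(2) that(3)] that ex
        by (simp add: a_def c_def)
      then show False using that \<open>x \<noteq> y\<close> by (metis linear)
    qed
    \<comment> \<open>\<open>s\<close> ends the initial block of smallest parts; the part at
      \<open>s + 1\<close> then separates the second type from the third.\<close>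
    define s where "s = Max {i \<in> {1..n}. lookup l i = a}"
    have ne: "1 \<in> {i \<in> {1..n}. lookup l i = a}" using n by (simp add: a_def)
    have "s \<in> {i \<in> {1..n}. lookup l i = a}" unfolding s_def using ne by (intro Max_in) auto
    then have s: "s \<in> {1..n}" "lookup l s = a" by auto
    have sn: "s < n" using s False by (metis atLeastAtMost_iff c_def le_neq_implies_less)
    have low: "lookup l i = a" if "i \<in> {1..n}" "i \<le> s" for i
      using bd(1)[OF that(1)] mono[OF that(1) s(1) that(2)] s(2) by simp
    have high: "a < lookup l i" if "i \<in> {1..n}" "s < i" for i
    proof -
      have "lookup l i \<noteq> a"
      proof
        assume "lookup l i = a"
        then have "i \<le> s" unfolding s_def using that by (intro Max_ge) auto
        then show False using that by simp
      qed
      then show ?thesis using bd(1)[OF that(1)] by simp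
    qed
    have s1: "s + 1 \<in> {1..n}" using sn by simp
    show ?thesis
    proof (cases "lookup l (s + 1) = c")
      case True
      have "lookup l i = c" if "i \<in> {1..n}" "s < i" for i
        using mono[OF s1 that(1)] bd(2)[OF that(1)] that True by simp
      then have "\<forall>i\<in>{1..n}. lookup l i = (if i \<le> s then a else c)"
        using low by simp
      moreover have "a < c" using \<open>a \<noteq> c\<close> bd(1)[OF n(2)] by (simp add: c_def)
      ultimately have ?T2
        using s(1) by (intro exI[of _ a] exI[of _ c] exI[of _ s]) simp
      then show ?thesis by blast
    next
      case False
      let ?b = "lookup l (s + 1)"
      have b: "a < ?b" "?b < c" using high[OF s1] bd(2)[OF s1] False by auto
      have "lookup l i = c" if "i \<in> {1..n}" "s < i" "i \<noteq> s + 1" for i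
        \<comment> \<open>The part at \<open>s + 1\<close> is already strictly between, so any later
          one, being above \<open>a\<close>, must be \<open>c\<close>.\<close>
        using mid[OF that(1) s1] high[OF that(1,2)] b bd(2)[OF that(1)] that(3) by linarith
      then have vals: "\<forall>i\<in>{1..n}. lookup l i = (if i \<le> s then a else if i = s + 1 then ?b else c)"
        using low by simp
      have "0 < s" "s + 1 \<le> n" using s(1) sn by auto
      then have ?T3 using b vals by blast
      then show ?thesis by blast
    qed
  qed
  show "strong_exchange n I" if "?T1 \<or> ?T2 \<or> ?T3"
    using that
  proof (elim disjE exE conjE)
    fix a assume "\<forall>i\<in>{1..n}. lookup l i = a"
    then show ?thesis by (intro strong_exchange_if[OF l assms(3), of a a]) auto
  next
    fix a b s assume "a < b" "\<forall>i\<in>{1..n}. lookup l i = (if i \<le> s then a else b)"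
    then show ?thesis by (intro strong_exchange_if[OF l assms(3), of a b]) (auto split: if_splits)
  next
    fix a b c s assume "a < b" "b < c"
      "\<forall>i\<in>{1..n}. lookup l i = (if i \<le> s then a else if i = s + 1 then b else c)"
    \<comment> \<open>Only index \<open>s + 1\<close> has a part strictly between \<open>a\<close>
      and \<open>c\<close>, which gives condition \<open>C\<close>.\<close>
    then show ?thesis by (intro strong_exchange_if[OF l assms(3), of a c]) (auto split: if_splits)
  qed
qed

end
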